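(* Let $(\tilde B_t)_{0\le t\le1}$ be a standard Brownian motion on $\mathbb{R}$ and let $g\in L^1([0,1],\mathbb{R}^K)$. Then, almost surely, $$\int_0^tg(s)\,e^{i\sqrt T\tilde B_s}\,ds\xrightarrow[T\to\infty]{}0\quad\text{uniformly in }t\in[0,1].$$
   Context: $K\ge1$ is an integer; the integral is computed coordinate-wise and takes values in $\mathbb{C}^K$. The parameter $T$ is a positive real number. *)

theory Defs
  imports "HOL-Probability.Probability"
begin

text \<open>Standard one-dimensional Brownian motion with time set \<open>[0,1]\<close>; the values \<open>B t\<close> for \<open>t\<close>
  outside \<open>[0,1]\<close> are irrelevant. The starting point and the continuity of paths are only required
  almost surely.\<close>

locale std_brownian_motion_01 = prob_space M
  for M :: "'a measure" and B :: "real \<Rightarrow> 'a \<Rightarrow> real" +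
  assumes random_variable: "\<And>t. t \<in> {0..1} \<Longrightarrow> B t \<in> borel_measurable M"
    and start: "AE \<omega> in M. B 0 \<omega> = 0"
    and indep_increments:
      "\<And>(n::nat) (t::nat \<Rightarrow> real). 0 \<le> t 0 \<Longrightarrow> (\<And>i. i < n \<Longrightarrow> t i \<le> t (Suc i)) \<Longrightarrow> t n \<le> 1 \<Longrightarrow>
         indep_vars (\<lambda>_. borel) (\<lambda>i \<omega>. B (t (Suc i)) \<omega> - B (t i) \<omega>) {..<n}"
    and normal_increments:
      \<comment> \<open>the second parameter of \<open>normal_density\<close> is the standard deviation\<close>
      "\<And>s t. 0 \<le> s \<Longrightarrow> s < t \<Longrightarrow> t \<le> 1 \<Longrightarrow>
         distributed M lborel (\<lambda>\<omega>. B t \<omega> - B s \<omega>) (normal_density 0 (sqrt (t - s)))"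
    and continuous_paths: "AE \<omega> in M. continuous_on {0..1} (\<lambda>t. B t \<omega>)"

end

(* For bounded h, E |int_0^1 h(s) e^(i theta B_s) ds|^2 is the integral of
   h(s) h(u) e^(-theta^2 |s-u| / 2) over the unit square, hence O(1/theta^2). This is summable along
   every grid theta = n/m, so almost surely the integral tends to 0 along all grids; as it is
   Lipschitz in theta (paths are bounded), it tends to 0 as theta tends to infinity.
   Applied to the restrictions of h to [0,t] for t in finer and finer finite grids, and using that the
   integral is Lipschitz in t, this gives uniformity in t. Truncation extends the result from bounded
   functions to L^1, with an L^1 error that does not depend on t and theta. *)
theory Submission
  imports Defs
begin

section \<open>Preliminaries from integration theory and analysis\<close>

abbreviation unit_lebesgue :: "real measure" where
  "unit_lebesgue \<equiv> lebesgue_on {0..1}"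

lemma finite_measure_unit_lebesgue: "finite_measure unit_lebesgue"
  by (rule finite_measureI) (simp add: emeasure_restrict_space)

lemma id_borel_measurable_unit_lebesgue [measurable]: "(\<lambda>x. x) \<in> borel_measurable unit_lebesgue"
  by (rule measurable_restrict_space1) (simp add: measurable_completion)

lemma borel_measurable_cnj [measurable]: "cnj \<in> borel_measurable borel"
  by (intro borel_measurable_continuous_onI continuous_intros)

text \<open>Splitting at \<open>u\<close> leaves two exponentials with explicit antiderivatives,
  each contributing at most \<open>1 / a\<close>. The bound is uniform in \<open>u\<close>, so it
  can later be integrated over \<open>u\<close>.\<close>

lemma integral_exp_neg_abs_diff_le:
  fixes a u :: real
  assumes a: "0 < a" and u: "u \<in> {0..1}"
  shows "(LINT s|unit_lebesgue. exp (- a * \<bar>s - u\<bar>)) \<le> 2 / a"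
proof -
  let ?f = "\<lambda>s. exp (- a * \<bar>s - u\<bar>)"
  have "((\<lambda>s. exp (- a * (u - s))) has_integral
      (exp (- a * (u - u)) / a - exp (- a * (u - 0)) / a)) {0..u}"
    using u a by (intro fundamental_theorem_of_calculus)
      (auto intro!: derivative_eq_intros simp flip: has_real_derivative_iff_has_vector_derivative)
  then have l: "(?f has_integral (1 - exp (- a * u)) / a) {0..u}"
    by (rule has_integral_eq_rhs[OF has_integral_eq, rotated])
      (use a in \<open>auto simp: diff_divide_distrib\<close>)
  have "((\<lambda>s. exp (- a * (s - u))) has_integral
      (- (exp (- a * (1 - u)) / a) - (- (exp (- a * (u - u)) / a)))) {u..1}"
    using u a by (intro fundamental_theorem_of_calculus)
      (auto intro!: derivative_eq_intros simp flip: has_real_derivative_iff_has_vector_derivative)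
  then have r: "(?f has_integral (1 - exp (- a * (1 - u))) / a) {u..1}"
    by (rule has_integral_eq_rhs[OF has_integral_eq, rotated])
      (use a in \<open>auto simp: diff_divide_distrib\<close>)
  have "(?f has_integral (1 - exp (- a * u)) / a + (1 - exp (- a * (1 - u))) / a) {0..1}"
    using u l r by (intro has_integral_combine) auto
  moreover have "continuous_on {0..1} ?f"
    by (intro continuous_intros)
  then have "integrable unit_lebesgue ?f"
    by (intro continuous_imp_integrable_real)
  then have "(LINT s|unit_lebesgue. ?f s) = integral {0..1} ?f"
    by (intro lebesgue_integral_eq_integral) auto
  ultimately have "(LINT s|unit_lebesgue. ?f s)
      = (1 - exp (- a * u)) / a + (1 - exp (- a * (1 - u))) / a"
    by (simp add: integral_unique)
  also have "\<dots> \<le> 1 / a + 1 / a"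
    using a by (intro add_mono divide_right_mono) auto
  finally show ?thesis by simp
qed

text \<open>Continuity makes the process a pointwise limit of processes that are piecewise constant
  in time, sampled at multiples of 1/(n+1). Joint measurability is what Fubini requires
  later.\<close>

lemma measurable_continuous_process:
  fixes X :: "real \<Rightarrow> 'a \<Rightarrow> real"
  assumes X: "\<And>t. X t \<in> borel_measurable M"
    and cont: "\<And>\<omega>. continuous_on UNIV (\<lambda>t. X t \<omega>)"
  shows "(\<lambda>(t, \<omega>). X t \<omega>) \<in> borel_measurable (borel \<Otimes>\<^sub>M M)"
proof (rule borel_measurable_LIMSEQ_real)
  fix p :: "real \<times> 'a"
  have lim: "(\<lambda>n. of_int \<lfloor>real (Suc n) * fst p\<rfloor> / real (Suc n)) \<longlonglongrightarrow> fst p"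
    by real_asymp
  show "(\<lambda>n. X (of_int \<lfloor>real (Suc n) * fst p\<rfloor> / real (Suc n)) (snd p))
      \<longlonglongrightarrow> (\<lambda>(t, \<omega>). X t \<omega>) p"
    using continuous_on_tendsto_compose[OF cont lim, of "snd p"] by (simp add: case_prod_beta)
next
  fix n
  have *: "(\<lambda>p. X (of_int i / real (Suc n)) (snd p)) \<in> borel_measurable (borel \<Otimes>\<^sub>M M)" for i :: int
    using X by measurable
  show "(\<lambda>p. X (of_int \<lfloor>real (Suc n) * fst p\<rfloor> / real (Suc n)) (snd p))
      \<in> borel_measurable (borel \<Otimes>\<^sub>M M)"
    \<comment> \<open>The floor takes only countably many values, and for each fixed value the map
      is a single measurable \<open>X t\<close> composed with \<open>snd\<close>.\<close>
    by (rule measurable_compose_countable[OF *, of "\<lambda>p. \<lfloor>real (Suc n) * fst p\<rfloor>"]) measurable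
qed

text \<open>A Borel-Cantelli type argument: integral and sum of nonnegative functions commute, so
  the sum has finite integral, is finite almost everywhere, and its terms tend to 0 there.\<close>

lemma AE_tendsto_zero_if_summable_integral:
  fixes f :: "nat \<Rightarrow> 'a \<Rightarrow> real"
  assumes f: "\<And>n. integrable M (f n)" "\<And>n x. 0 \<le> f n x"
    and sm: "summable (\<lambda>n. \<integral>x. f n x \<partial>M)"
  shows "AE x in M. (\<lambda>n. f n x) \<longlonglongrightarrow> 0"
proof -
  have [measurable]: "f n \<in> borel_measurable M" for n using f by auto
  have "(\<integral>\<^sup>+x. (\<Sum>n. ennreal (f n x)) \<partial>M) = (\<Sum>n. ennreal (\<integral>x. f n x \<partial>M))"
    using f by (simp add: nn_integral_suminf nn_integral_eq_integral)
  also have "\<dots> \<noteq> \<infinity>"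
    unfolding infinity_ennreal_def
    using f(2) by (intro ennreal_suminf_neq_top sm Bochner_Integration.integral_nonneg)
  finally have "AE x in M. (\<Sum>n. ennreal (f n x)) \<noteq> \<infinity>"
    by (intro nn_integral_noteq_infinite) auto
  then show ?thesis
  proof eventually_elim
    case (elim x)
    then have "summable (\<lambda>n. f n x)"
      unfolding infinity_ennreal_def by (intro summable_suminf_not_top f(2))
    then show ?case
      by (rule summable_LIMSEQ_zero)
  qed
qed

text \<open>A chord of the unit circle, of length 2 |sin ((x - y) / 2)|, is no longer than the arc
  it cuts off.\<close>

lemma norm_iexp_diff_le: "norm (iexp x - iexp y) \<le> \<bar>x - y\<bar>"
proof -
  have "iexp x - iexp y = iexp y * (iexp (x - y) - 1)"
    by (simp add: algebra_simps flip: exp_add)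
  then have "norm (iexp x - iexp y) = 2 * \<bar>sin ((x - y) / 2)\<bar>"
    by (simp only: norm_mult dist_exp_i_1 norm_exp_i_times)
  then show ?thesis
    using abs_sin_x_le_abs_x[of "(x - y) / 2"] by simp
qed

section \<open>Reduction of limits and uniformity to countable grids\<close>

lemma nat_floor_grid:
  fixes x d :: real
  assumes "0 \<le> x" "0 < d"
  shows "\<bar>x - real (nat \<lfloor>x * d\<rfloor>) / d\<bar> \<le> 1 / d"
proof -
  have "x - real (nat \<lfloor>x * d\<rfloor>) / d = (x * d - real_of_int \<lfloor>x * d\<rfloor>) / d"
    using assms by (simp add: of_nat_floor field_simps)
  moreover have "\<bar>x * d - real_of_int \<lfloor>x * d\<rfloor>\<bar> \<le> 1"
    by linarith
  ultimately show ?thesis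
    using assms by (simp add: divide_right_mono)
qed

text \<open>For each tolerance one fine grid suffices: the Lipschitz bound pays \<open>e / 2\<close>
  for moving to a grid point, convergence along the grid pays the rest. Only countably many
  sequences are involved, so for random \<open>F\<close> they can be treated outside a common null
  set.\<close>

lemma tendsto_zero_at_top_if_grids:
  fixes F :: "real \<Rightarrow> 'b::real_normed_vector"
  assumes L: "\<And>x y. norm (F x - F y) \<le> L * \<bar>x - y\<bar>"
    and grid: "\<And>m::nat. (\<lambda>n. F (real (Suc n) / real (Suc m))) \<longlonglongrightarrow> 0"
  shows "(F \<longlongrightarrow> 0) at_top"
proof (rule tendstoI)
  fix e :: real assume e: "0 < e"
  have "(\<lambda>m. L / real (Suc m)) \<longlonglongrightarrow> 0" by real_asymp
  then have "\<forall>\<^sub>F m in sequentially. L / real (Suc m) < e / 2"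
    using e by (intro order_tendstoD) auto
  then obtain m where m: "L / real (Suc m) < e / 2"
    by (auto dest: eventually_happens)
  obtain N where N: "norm (F (real (Suc n) / real (Suc m))) < e / 2" if "n \<ge> N" for n
    using tendstoD[OF grid[of m], of "e / 2"] e by (auto simp: eventually_sequentially)
  show "\<forall>\<^sub>F x in at_top. dist (F x) 0 < e"
    using eventually_ge_at_top[of "real (Suc N)"]
  proof eventually_elim
    case (elim x)
    define k where "k = nat \<lfloor>x * real (Suc m)\<rfloor>"
    \<comment> \<open>The grid starts at numerator 1, so the index \<open>k\<close> has to be a
      successor. Since the mesh is at most 1, \<open>x\<close> \<ge> \<open>Suc N\<close> already
      forces \<open>k\<close> \<ge> \<open>Suc N\<close>.\<close>
    have "real (Suc N) * 1 \<le> x * real (Suc m)"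
      using elim by (intro mult_mono) auto
    then have "Suc N \<le> k"
      unfolding k_def by (intro le_nat_floor) simp
    then obtain n where n: "k = Suc n" "n \<ge> N" by (cases k) auto
    have "\<bar>x - real k / real (Suc m)\<bar> \<le> 1 / real (Suc m)"
      unfolding k_def using elim by (intro nat_floor_grid) auto
    \<comment> \<open>Nonnegativity of \<open>L\<close> follows from the Lipschitz hypothesis
      itself, taken at the points 0 and 1.\<close>
    moreover have "0 \<le> L" using order_trans[OF norm_ge_zero L[of 0 1]] by simp
    ultimately have "norm (F x - F (real k / real (Suc m))) \<le> L * (1 / real (Suc m))"
      using L[of x "real k / real (Suc m)"] by (meson mult_left_mono order_trans)
    then have "norm (F x - F (real k / real (Suc m))) < e / 2"
      by (rule le_less_trans) (use m in simp)
    then show ?case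
      using N[OF n(2)] norm_triangle_sub[of "F x" "F (real k / real (Suc m))"]
      unfolding n(1) dist_norm by simp
  qed
qed

text \<open>As \<open>L\<close> does not depend on \<theta>, finitely many nodes control the whole
  interval, and finitely many statements about large \<theta> hold simultaneously.\<close>

lemma uniform_limit_zero_if_grids:
  fixes F :: "real \<Rightarrow> real \<Rightarrow> 'b::real_normed_vector"
  assumes L: "\<And>\<theta> x y. x \<in> {0..1} \<Longrightarrow> y \<in> {0..1} \<Longrightarrow> norm (F \<theta> x - F \<theta> y) \<le> L * \<bar>x - y\<bar>"
    and grid: "\<And>m j::nat. j \<le> Suc m \<Longrightarrow> ((\<lambda>\<theta>. F \<theta> (real j / real (Suc m))) \<longlongrightarrow> 0) at_top"
  shows "uniform_limit {0..1} F (\<lambda>_. 0) at_top"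
proof (rule uniform_limitI)
  fix e :: real assume e: "0 < e"
  have "(\<lambda>m. L / real (Suc m)) \<longlonglongrightarrow> 0" by real_asymp
  then have "\<forall>\<^sub>F m in sequentially. L / real (Suc m) < e / 2"
    using e by (intro order_tendstoD) auto
  then obtain m where m: "L / real (Suc m) < e / 2"
    by (auto dest: eventually_happens)
  have "\<forall>\<^sub>F \<theta> in at_top. \<forall>j\<in>{..Suc m}. norm (F \<theta> (real j / real (Suc m))) < e / 2"
    using tendstoD[OF grid[of _ m], of _ "e / 2"] e by (intro eventually_ball_finite) auto
  then show "\<forall>\<^sub>F \<theta> in at_top. \<forall>x\<in>{0..1}. dist (F \<theta> x) 0 < e"
  proof eventually_elim
    case (elim \<theta>)
    show ?case
    proof
      fix x :: real assume x: "x \<in> {0..1}"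
      define k where "k = nat \<lfloor>x * real (Suc m)\<rfloor>"
      \<comment> \<open>The node must stay within [0,1], where the Lipschitz bound and the grid
        hypothesis are available.\<close>
      have "x * real (Suc m) \<le> 1 * real (Suc m)"
        using x by (intro mult_right_mono) auto
      then have "\<lfloor>x * real (Suc m)\<rfloor> \<le> \<lfloor>1 * real (Suc m)\<rfloor>"
        by (rule floor_mono)
      also have "\<dots> = int (Suc m)"
        unfolding mult_1 by (rule floor_of_nat)
      finally have k: "k \<le> Suc m"
        unfolding k_def by (simp only: nat_le_iff)
      have "\<bar>x - real k / real (Suc m)\<bar> \<le> 1 / real (Suc m)"
        unfolding k_def using x by (intro nat_floor_grid) auto
      moreover have "0 \<le> L" using order_trans[OF norm_ge_zero L[of 0 1]] by simp
      moreover have "norm (F \<theta> x - F \<theta> (real k / real (Suc m))) \<le> L * \<bar>x - real k / real (Suc m)\<bar>"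
        using x k by (intro L) (auto simp: field_simps)
      ultimately have "norm (F \<theta> x - F \<theta> (real k / real (Suc m))) \<le> L * (1 / real (Suc m))"
        by (meson mult_left_mono order_trans)
      then have "norm (F \<theta> x - F \<theta> (real k / real (Suc m))) < e / 2"
        by (rule le_less_trans) (use m in simp)
      moreover have "norm (F \<theta> (real k / real (Suc m))) < e / 2" using elim k by auto
      ultimately show "dist (F \<theta> x) 0 < e"
        using norm_triangle_sub[of "F \<theta> x" "F \<theta> (real k / real (Suc m))"]
        unfolding dist_norm by simp
    qed
  qed
qed

section \<open>Oscillatory integrals along one fixed continuous path\<close>

abbreviation osc_integral :: "(real \<Rightarrow> real) \<Rightarrow> (real \<Rightarrow> real) \<Rightarrow> real \<Rightarrow> complex" where
  "osc_integral h x \<theta> \<equiv> (CLINT s|unit_lebesgue. complex_of_real (h s) * iexp (\<theta> * x s))"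

lemma integrable_osc:
  assumes "integrable unit_lebesgue h" "continuous_on UNIV x"
  shows "integrable unit_lebesgue (\<lambda>s. complex_of_real (h s) * iexp (\<theta> * x s))"
proof -
  have [measurable]: "x \<in> borel_measurable borel"
    using assms by (intro borel_measurable_continuous_onI)
  have [measurable]: "h \<in> borel_measurable unit_lebesgue"
    using assms by auto
  show ?thesis
    using assms(1) by (rule Bochner_Integration.integrable_bound) (auto simp: norm_mult)
qed

text \<open>The phase has modulus 1, so the estimate depends on neither the path nor \<theta>. It
  serves both for moving the endpoint of \<open>{0..t}\<close> and for truncating
  \<open>h\<close>.\<close>

lemma norm_osc_integral_diff_le:
  assumes "integrable unit_lebesgue h" "integrable unit_lebesgue k" "continuous_on UNIV x"
  shows "norm (osc_integral h x \<theta> - osc_integral k x \<theta>) \<le> (LINT s|unit_lebesgue. \<bar>h s - k s\<bar>)"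
proof -
  have "osc_integral h x \<theta> - osc_integral k x \<theta> = (CLINT s|unit_lebesgue.
      complex_of_real (h s) * iexp (\<theta> * x s) - complex_of_real (k s) * iexp (\<theta> * x s))"
    using assms by (intro Bochner_Integration.integral_diff[symmetric] integrable_osc)
  also have "\<dots> = osc_integral (\<lambda>s. h s - k s) x \<theta>"
    by (simp add: algebra_simps)
  also have "norm \<dots> \<le> (LINT s|unit_lebesgue. \<bar>h s - k s\<bar>)"
    by (rule integral_norm_bound[THEN order_trans]) (simp add: norm_mult flip: of_real_diff)
  finally show ?thesis .
qed

text \<open>At time \<open>s\<close> the phase is Lipschitz in \<theta> with constant |x s|. The
  bound \<open>K\<close> may depend on the path, since the lemma is used for one \<omega> at a
  time.\<close>

lemma lipschitz_osc_integral:
  assumes h: "integrable unit_lebesgue h" and x: "continuous_on UNIV x"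
    and K: "\<And>s. s \<in> {0..1} \<Longrightarrow> \<bar>x s\<bar> \<le> K"
  shows "norm (osc_integral h x \<theta> - osc_integral h x \<eta>) \<le> (LINT s|unit_lebesgue. \<bar>h s\<bar>) * K * \<bar>\<theta> - \<eta>\<bar>"
proof -
  have "osc_integral h x \<theta> - osc_integral h x \<eta> = (CLINT s|unit_lebesgue.
      complex_of_real (h s) * iexp (\<theta> * x s) - complex_of_real (h s) * iexp (\<eta> * x s))"
    using assms by (intro Bochner_Integration.integral_diff[symmetric] integrable_osc)
  also have "norm \<dots> \<le> (LINT s|unit_lebesgue. \<bar>h s\<bar> * (K * \<bar>\<theta> - \<eta>\<bar>))"
  proof (rule Bochner_Integration.integral_norm_bound_integral)
    fix s assume "s \<in> space unit_lebesgue"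
    then have s: "\<bar>x s\<bar> \<le> K" using K by simp
    have "norm (iexp (\<theta> * x s) - iexp (\<eta> * x s)) \<le> \<bar>x s\<bar> * \<bar>\<theta> - \<eta>\<bar>"
      using norm_iexp_diff_le[of "\<theta> * x s" "\<eta> * x s"]
      by (simp add: abs_mult mult.commute flip: left_diff_distrib)
    also have "\<dots> \<le> K * \<bar>\<theta> - \<eta>\<bar>"
      using s by (intro mult_right_mono) auto
    finally show "norm (complex_of_real (h s) * iexp (\<theta> * x s) - complex_of_real (h s) * iexp (\<eta> * x s))
        \<le> \<bar>h s\<bar> * (K * \<bar>\<theta> - \<eta>\<bar>)"
      by (simp add: norm_mult mult_left_mono flip: right_diff_distrib)
  next
    show "integrable unit_lebesgue (\<lambda>s. \<bar>h s\<bar> * (K * \<bar>\<theta> - \<eta>\<bar>))"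
      using h by simp
  qed (intro Bochner_Integration.integrable_diff integrable_osc h x)
  also have "\<dots> = (LINT s|unit_lebesgue. \<bar>h s\<bar>) * K * \<bar>\<theta> - \<eta>\<bar>"
    by simp
  finally show ?thesis .
qed

section \<open>Path regularity and the characteristic function of increments\<close>

context std_brownian_motion_01
begin

text \<open>\<open>B\<close> is measurable only at times in [0,1] and continuous only almost surely.
  The joint measurability argument needs both properties at all times and for every
  \<omega>.\<close>

lemma continuous_modification:
  obtains X where "\<And>t. X t \<in> borel_measurable M" "\<And>\<omega>. continuous_on UNIV (\<lambda>t. X t \<omega>)"
    "AE \<omega> in M. \<forall>t\<in>{0..1}. X t \<omega> = B t \<omega>"
proof -
  \<comment> \<open>The set of discontinuous paths need not be measurable, hence the passage to a
    null set \<open>N\<close> containing it.\<close>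
  obtain N where N: "N \<in> null_sets M" "{\<omega> \<in> space M. \<not> continuous_on {0..1} (\<lambda>t. B t \<omega>)} \<subseteq> N"
    using continuous_paths by (auto elim!: AE_E)
  \<comment> \<open>Clamping time to [0,1] extends good paths by constants to the whole line; the
    paths in \<open>N\<close> are replaced by the zero path.\<close>
  define X where "X t \<omega> = (if \<omega> \<in> space M - N then B (max 0 (min 1 t)) \<omega> else 0)" for t \<omega>
  show ?thesis
  proof
    fix t
    have [measurable]: "N \<in> sets M" "B (max 0 (min 1 t)) \<in> borel_measurable M"
      using N random_variable[of "max 0 (min 1 t)"] by auto
    show "X t \<in> borel_measurable M"
      unfolding X_def by measurable
  next
    fix \<omega>
    show "continuous_on UNIV (\<lambda>t. X t \<omega>)"
    proof (cases "\<omega> \<in> space M - N")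
      case True
      then have "continuous_on {0..1} (\<lambda>t. B t \<omega>)" using N by blast
      then have "continuous_on UNIV (\<lambda>t::real. B (max 0 (min 1 t)) \<omega>)"
        by (rule continuous_on_compose2) (auto intro!: continuous_intros)
      then show ?thesis using True by (simp add: X_def)
    next
      case False
      then have "X t \<omega> = 0" for t by (auto simp: X_def)
      then show ?thesis by simp
    qed
  next
    show "AE \<omega> in M. \<forall>t\<in>{0..1}. X t \<omega> = B t \<omega>"
      using AE_not_in[OF N(1)] AE_space by eventually_elim (auto simp: X_def)
  qed
qed

text \<open>Division by the standard deviation reduces this to the characteristic function of the
  standard normal law at \<theta> \<open>sqrt (t - s)\<close>.\<close>

lemma char_increment_ordered:
  assumes "0 \<le> s" "s < t" "t \<le> 1"
  shows "(CLINT \<omega>|M. exp (\<i> * complex_of_real (\<theta> * (B t \<omega> - B s \<omega>)))) =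
    exp (- (\<theta>\<^sup>2) * (t - s) / 2)"
proof -
  let ?\<sigma> = "sqrt (t - s)"
  have \<sigma>: "0 < ?\<sigma>" using assms by simp
  have [measurable]: "B s \<in> borel_measurable M" "B t \<in> borel_measurable M"
    using assms by (auto intro: random_variable)
  have "distributed M lborel (\<lambda>\<omega>. ((B t \<omega> - B s \<omega>) - 0) / ?\<sigma>) std_normal_density"
    by (rule normal_standard_normal_convert[THEN iffD1, OF \<sigma> normal_increments[OF assms]])
  then have "distr M lborel (\<lambda>\<omega>. (B t \<omega> - B s \<omega>) / ?\<sigma>) = std_normal_distribution"
    by (simp add: distributed_distr_eq_density)
  then have d: "distr M borel (\<lambda>\<omega>. (B t \<omega> - B s \<omega>) / ?\<sigma>) = std_normal_distribution"
    by (simp cong: distr_cong)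
  have "(CLINT \<omega>|M. exp (\<i> * complex_of_real (\<theta> * (B t \<omega> - B s \<omega>)))) =
      (CLINT \<omega>|M. iexp (\<theta> * ?\<sigma> * ((B t \<omega> - B s \<omega>) / ?\<sigma>)))"
    using \<sigma> by simp
  also have "\<dots> = char std_normal_distribution (\<theta> * ?\<sigma>)"
    unfolding char_def d[symmetric] by (subst integral_distr) auto
  also have "\<dots> = exp (- (\<theta>\<^sup>2) * (t - s) / 2)"
    using assms by (simp add: char_std_normal_distribution power_mult_distrib)
  finally show ?thesis .
qed

lemma char_increment:
  assumes "s \<in> {0..1}" "t \<in> {0..1}"
  shows "(CLINT \<omega>|M. exp (\<i> * complex_of_real (\<theta> * (B t \<omega> - B s \<omega>)))) =
    exp (- (\<theta>\<^sup>2) * \<bar>t - s\<bar> / 2)"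
proof (cases s t rule: linorder_cases)
  case less
  then show ?thesis using assms char_increment_ordered[of s t \<theta>] by simp
next
  case equal
  then show ?thesis by (simp add: prob_space)
next
  case greater
  \<comment> \<open>Exchanging the two times flips the sign of the increment, which is absorbed into
    \<theta>.\<close>
  then show ?thesis using assms char_increment_ordered[of t s "- \<theta>"] by (simp add: algebra_simps)
qed

section \<open>Second moments and almost sure uniform convergence for a scalar function\<close>

context
  fixes X :: "real \<Rightarrow> 'a \<Rightarrow> real"
  assumes X_measurable: "\<And>t. X t \<in> borel_measurable M"
    and X_cont: "\<And>\<omega>. continuous_on UNIV (\<lambda>t. X t \<omega>)"
    and X_eq: "AE \<omega> in M. \<forall>t\<in>{0..1}. X t \<omega> = B t \<omega>"
begin

text \<open>In \<open>F\<close> times its conjugate only increments of \<open>X\<close> occur.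
  Fubini moves the expectation inside, where it becomes an exponential kernel; |h s * h u| is
  bounded by \<open>C\<^sup>2\<close> and the kernel integrates to at most 4 / \<theta>^2.\<close>

lemma second_moment_le:
  fixes h :: "real \<Rightarrow> real"
  assumes h [measurable]: "h \<in> borel_measurable unit_lebesgue"
    and C: "\<And>s. \<bar>h s\<bar> \<le> C" and \<theta>: "\<theta> \<noteq> 0"
  defines "F \<equiv> \<lambda>\<omega>. CLINT s|unit_lebesgue. complex_of_real (h s) * iexp (\<theta> * X s \<omega>)"
  shows "F \<in> borel_measurable M" "(\<integral>\<omega>. (norm (F \<omega>))\<^sup>2 \<partial>M) \<le> 4 * C\<^sup>2 / \<theta>\<^sup>2"
proof -
  interpret U: finite_measure unit_lebesgue by (rule finite_measure_unit_lebesgue)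
  interpret UU: pair_sigma_finite unit_lebesgue unit_lebesgue ..
  let ?P = "unit_lebesgue \<Otimes>\<^sub>M unit_lebesgue"
  interpret P: finite_measure ?P
    by (intro finite_measure_pair_measure finite_measure_unit_lebesgue)
  interpret PM: pair_sigma_finite ?P M ..
  interpret PM': finite_measure "?P \<Otimes>\<^sub>M M"
    by (intro finite_measure_pair_measure) unfold_locales
  have C0: "0 \<le> C" using C[of 0] by linarith
  have hh: "\<bar>h s * h u\<bar> \<le> C\<^sup>2" for s u
    unfolding abs_mult power2_eq_square by (intro mult_mono C C0) auto
  define a where "a s \<omega> = complex_of_real (h s) * iexp (\<theta> * X s \<omega>)" for s \<omega>
  have F: "F = (\<lambda>\<omega>. CLINT s|unit_lebesgue. a s \<omega>)"
    by (simp add: F_def a_def)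
  have a_measurable: "case_prod a \<in> borel_measurable (unit_lebesgue \<Otimes>\<^sub>M M)"
  proof -
    have "(\<lambda>p. X (fst p) (snd p)) \<in> borel_measurable (unit_lebesgue \<Otimes>\<^sub>M M)"
      using measurable_compose[OF measurable_Pair[OF measurable_compose[OF measurable_fst
          id_borel_measurable_unit_lebesgue] measurable_snd]
          measurable_continuous_process[OF X_measurable X_cont]] by simp
    note [measurable] = this
    show ?thesis
      unfolding a_def case_prod_beta by measurable
  qed
  then have "(\<lambda>(\<omega>, s). a s \<omega>) \<in> borel_measurable (M \<Otimes>\<^sub>M unit_lebesgue)"
    by (rule measurable_pair_swap[where f="case_prod a", simplified])
  then show "F \<in> borel_measurable M"
    unfolding F by (rule U.borel_measurable_lebesgue_integral)
  have aa: "a s \<omega> * cnj (a u \<omega>) = complex_of_real (h s * h u) * iexp (\<theta> * (X s \<omega> - X u \<omega>))" for s u \<omega>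
    by (simp add: a_def exp_cnj exp_minus exp_diff algebra_simps divide_inverse)
  have aa_le: "norm (a s \<omega> * cnj (a u \<omega>)) \<le> C\<^sup>2" for s u \<omega>
    unfolding aa using hh[of s u] by (simp add: norm_mult)
  \<comment> \<open>For fixed \<omega> the double integral factors into \<open>F \<omega>\<close>
    and its conjugate. Membership of \<omega> in the space is needed for measurability of the
    section.\<close>
  have sq: "complex_of_real ((norm (F \<omega>))\<^sup>2) = (CLINT p|?P. a (fst p) \<omega> * cnj (a (snd p) \<omega>))"
    if \<omega>: "\<omega> \<in> space M" for \<omega>
  proof -
    have [measurable]: "(\<lambda>s. a s \<omega>) \<in> borel_measurable unit_lebesgue"
      using measurable_compose[OF measurable_Pair2'[OF \<omega>] a_measurable] by simp
    have "(\<lambda>p. a (fst p) \<omega> * cnj (a (snd p) \<omega>)) \<in> borel_measurable ?P"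
      by measurable
    then have i: "integrable ?P (\<lambda>p. a (fst p) \<omega> * cnj (a (snd p) \<omega>))"
      using aa_le by (intro P.integrable_const_bound[where B="C\<^sup>2"] AE_I2)
    have "complex_of_real ((norm (F \<omega>))\<^sup>2) = F \<omega> * cnj (F \<omega>)"
      by (rule complex_norm_square)
    also have "\<dots> = (CLINT s|unit_lebesgue. CLINT u|unit_lebesgue. a s \<omega> * cnj (a u \<omega>))"
      unfolding F by (simp flip: integral_cnj)
    also have "\<dots> = (CLINT p|?P. a (fst p) \<omega> * cnj (a (snd p) \<omega>))"
      using UU.integral_fst'[OF i] by simp
    finally show ?thesis .
  qed
  have "(\<lambda>q. case_prod a (fst (fst q), snd q) * cnj (case_prod a (snd (fst q), snd q)))
      \<in> borel_measurable (?P \<Otimes>\<^sub>M M)"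
    by (intro borel_measurable_times measurable_compose[OF _ borel_measurable_cnj] measurable_compose[OF _ a_measurable])
      measurable
  then have iPM: "integrable (?P \<Otimes>\<^sub>M M) (\<lambda>(p, \<omega>). a (fst p) \<omega> * cnj (a (snd p) \<omega>))"
    unfolding case_prod_beta using aa_le by (intro PM'.integrable_const_bound[where B="C\<^sup>2"] AE_I2) auto
  \<comment> \<open>At times in [0,1] \<open>X\<close> and \<open>B\<close> agree almost surely, so
    the Gaussian law of the increments of \<open>B\<close> carries over.\<close>
  have char: "(CLINT \<omega>|M. a s \<omega> * cnj (a u \<omega>)) =
      complex_of_real (h s * h u * exp (- (\<theta>\<^sup>2 / 2) * \<bar>s - u\<bar>))" if "s \<in> {0..1}" "u \<in> {0..1}" for s u
  proof -
    note X_measurable [measurable]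
    have [measurable]: "B s \<in> borel_measurable M" "B u \<in> borel_measurable M"
      using that by (auto intro: random_variable)
    have "(CLINT \<omega>|M. iexp (\<theta> * (X s \<omega> - X u \<omega>))) = (CLINT \<omega>|M. iexp (\<theta> * (B s \<omega> - B u \<omega>)))"
      using X_eq that by (intro integral_cong_AE) auto
    then show ?thesis
      using char_increment[OF that(2,1), of \<theta>] unfolding aa by simp
  qed
  \<comment> \<open>The identity is derived over the complex numbers, where the phases live. Both
    ends are embedded reals, so it descends to a real identity, to which monotonicity
    applies.\<close>
  have "complex_of_real (\<integral>\<omega>. (norm (F \<omega>))\<^sup>2 \<partial>M) = (CLINT \<omega>|M. CLINT p|?P. a (fst p) \<omega> * cnj (a (snd p) \<omega>))"
    unfolding integral_complex_of_real[symmetric]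
    by (intro Bochner_Integration.integral_cong refl) (simp only: sq)
  also have "\<dots> = (CLINT p|?P. CLINT \<omega>|M. a (fst p) \<omega> * cnj (a (snd p) \<omega>))"
    by (rule PM.Fubini_integral[OF iPM])
  also have "\<dots> = (CLINT p|?P. complex_of_real (h (fst p) * h (snd p) * exp (- (\<theta>\<^sup>2 / 2) * \<bar>fst p - snd p\<bar>)))"
    by (intro Bochner_Integration.integral_cong refl char) (auto simp: space_pair_measure)
  finally have "(\<integral>\<omega>. (norm (F \<omega>))\<^sup>2 \<partial>M) = (\<integral>p. h (fst p) * h (snd p) * exp (- (\<theta>\<^sup>2 / 2) * \<bar>fst p - snd p\<bar>) \<partial>?P)"
    unfolding integral_complex_of_real of_real_eq_iff .
  also have "\<dots> \<le> (\<integral>p. C\<^sup>2 * exp (- (\<theta>\<^sup>2 / 2) * \<bar>fst p - snd p\<bar>) \<partial>?P)"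
  proof (intro integral_mono)
    show "integrable ?P (\<lambda>p. h (fst p) * h (snd p) * exp (- (\<theta>\<^sup>2 / 2) * \<bar>fst p - snd p\<bar>))"
    proof (intro P.integrable_const_bound[where B="C\<^sup>2"] AE_I2)
      fix p
      have "\<bar>h (fst p) * h (snd p)\<bar> * \<bar>exp (- (\<theta>\<^sup>2 / 2) * \<bar>fst p - snd p\<bar>)\<bar> \<le> C\<^sup>2 * 1"
        by (intro mult_mono hh) auto
      then show "norm (h (fst p) * h (snd p) * exp (- (\<theta>\<^sup>2 / 2) * \<bar>fst p - snd p\<bar>)) \<le> C\<^sup>2"
        by (simp add: abs_mult)
    qed measurable
    show "integrable ?P (\<lambda>p. C\<^sup>2 * exp (- (\<theta>\<^sup>2 / 2) * \<bar>fst p - snd p\<bar>))"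
      by (intro P.integrable_const_bound[where B="C\<^sup>2"]) (auto intro!: AE_I2 mult_left_le)
  next
    fix p
    show "h (fst p) * h (snd p) * exp (- (\<theta>\<^sup>2 / 2) * \<bar>fst p - snd p\<bar>) \<le> C\<^sup>2 * exp (- (\<theta>\<^sup>2 / 2) * \<bar>fst p - snd p\<bar>)"
      using hh[of "fst p" "snd p"] by (intro mult_right_mono) auto
  qed
  also have "\<dots> = C\<^sup>2 * (\<integral>p. exp (- (\<theta>\<^sup>2 / 2) * \<bar>fst p - snd p\<bar>) \<partial>?P)"
    by simp
  also have "\<dots> \<le> C\<^sup>2 * (4 / \<theta>\<^sup>2)"
  proof (intro mult_left_mono)
    have i: "integrable ?P (\<lambda>(s, u). exp (- (\<theta>\<^sup>2 / 2) * \<bar>s - u\<bar>))"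
      by (intro P.integrable_const_bound[where B=1]) auto
    have "(\<integral>p. exp (- (\<theta>\<^sup>2 / 2) * \<bar>fst p - snd p\<bar>) \<partial>?P) = (LINT u|unit_lebesgue. LINT s|unit_lebesgue. exp (- (\<theta>\<^sup>2 / 2) * \<bar>s - u\<bar>))"
      using UU.integral_snd[OF i] unfolding case_prod_beta by (rule sym)
    \<comment> \<open>The kernel estimate is used with rate \<open>a\<close> = \<theta>^2 / 2; the
      outer integral is over an interval of length 1.\<close>
    also have "\<dots> \<le> (LINT u|unit_lebesgue. 2 / (\<theta>\<^sup>2 / 2))"
      using \<theta> by (intro integral_mono UU.integrable_snd[OF i] integral_exp_neg_abs_diff_le) auto
    also have "\<dots> = 4 / \<theta>\<^sup>2"
      by (simp add: measure_restrict_space)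
    finally show "(\<integral>p. exp (- (\<theta>\<^sup>2 / 2) * \<bar>fst p - snd p\<bar>) \<partial>?P) \<le> 4 / \<theta>\<^sup>2" .
  qed simp
  finally show "(\<integral>\<omega>. (norm (F \<omega>))\<^sup>2 \<partial>M) \<le> 4 * C\<^sup>2 / \<theta>\<^sup>2"
    by (simp add: mult.commute)
qed

text \<open>At \<theta> = (n+1)/(m+1) the second moment is at most a constant depending on
  \<open>m\<close> times 1/(n+1)^2, hence summable in \<open>n\<close>. The countably many
  \<open>m\<close> share one null set, and Lipschitz continuity fills the gaps between grid
  points.\<close>

lemma AE_osc_integral_tendsto_zero:
  assumes h [measurable]: "h \<in> borel_measurable unit_lebesgue" and C: "\<And>s. \<bar>h s\<bar> \<le> C"
  shows "AE \<omega> in M. (osc_integral h (\<lambda>s. X s \<omega>) \<longlongrightarrow> 0) at_top"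
proof -
  interpret U: finite_measure unit_lebesgue by (rule finite_measure_unit_lebesgue)
  have ih: "integrable unit_lebesgue h"
    by (rule U.integrable_const_bound[where B=C]) (simp_all add: C)
  have "AE \<omega> in M. \<forall>m. (\<lambda>n. osc_integral h (\<lambda>s. X s \<omega>) (real (Suc n) / real (Suc m))) \<longlonglongrightarrow> 0"
  proof (subst AE_all_countable, rule allI)
    fix m
    let ?\<theta> = "\<lambda>n. real (Suc n) / real (Suc m)"
    define F where "F n \<omega> = osc_integral h (\<lambda>s. X s \<omega>) (?\<theta> n)" for n \<omega>
    have "?\<theta> n \<noteq> 0" for n by simp
    note moment = second_moment_le[OF h C this, folded F_def]
    have F_measurable [measurable]: "F n \<in> borel_measurable M" for n
      unfolding F_def[abs_def] by (rule moment(1)[unfolded F_def])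
    \<comment> \<open>This crude bound makes the squared norms integrable over the probability
      space.\<close>
    have bound: "norm (F n \<omega>) \<le> C" for n \<omega>
    proof -
      have "norm (F n \<omega>) \<le> (LINT s|unit_lebesgue. C)"
        using C ih X_cont unfolding F_def
        by (intro Bochner_Integration.integral_norm_bound_integral integrable_osc)
          (auto simp: norm_mult)
      then show ?thesis by (simp add: measure_restrict_space)
    qed
    have "AE \<omega> in M. (\<lambda>n. (norm (F n \<omega>))\<^sup>2) \<longlonglongrightarrow> 0"
    proof (rule AE_tendsto_zero_if_summable_integral)
      show "integrable M (\<lambda>\<omega>. (norm (F n \<omega>))\<^sup>2)" for n
        using bound by (intro integrable_const_bound[where B="C\<^sup>2"] AE_I2) (auto intro: power_mono)
      have "summable (\<lambda>n. (4 * C\<^sup>2 * (real (Suc m))\<^sup>2) * (1 / (real (Suc n))\<^sup>2))"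
        using inverse_power_summable[of 2, where 'a=real]
        by (intro summable_mult) (subst summable_Suc_iff, simp add: inverse_eq_divide)
      then show "summable (\<lambda>n. \<integral>\<omega>. (norm (F n \<omega>))\<^sup>2 \<partial>M)"
      proof (rule summable_comparison_test')
        show "norm (\<integral>\<omega>. (norm (F n \<omega>))\<^sup>2 \<partial>M) \<le> (4 * C\<^sup>2 * (real (Suc m))\<^sup>2) * (1 / (real (Suc n))\<^sup>2)" for n
          using moment(2)[of n] by (simp add: power_divide)
      qed
    qed simp
    then have "AE \<omega> in M. (\<lambda>n. F n \<omega>) \<longlonglongrightarrow> 0"
    proof eventually_elim
      case (elim \<omega>)
      then have "(\<lambda>n. norm (F n \<omega>)) \<longlonglongrightarrow> 0"
        using tendsto_real_sqrt by fastforce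
      then show ?case
        by (rule tendsto_norm_zero_cancel)
    qed
    then show "AE \<omega> in M. (\<lambda>n. osc_integral h (\<lambda>s. X s \<omega>) (?\<theta> n)) \<longlonglongrightarrow> 0"
      unfolding F_def .
  qed
  then show ?thesis
  proof eventually_elim
    case (elim \<omega>)
    \<comment> \<open>Compactness of [0,1] bounds the path, giving a Lipschitz constant in \<theta>
      for this \<omega>.\<close>
    have "bounded ((\<lambda>t. X t \<omega>) ` {0..1})"
      using X_cont by (intro compact_imp_bounded compact_continuous_image) (auto intro: continuous_on_subset)
    then obtain K where K: "\<forall>s\<in>{0..1}. \<bar>X s \<omega>\<bar> \<le> K"
      by (auto simp: bounded_iff)
    show ?case
      by (rule tendsto_zero_at_top_if_grids[OF lipschitz_osc_integral[OF ih X_cont K[rule_format]]])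
        (use elim in auto)
  qed
qed

text \<open>The pointwise result is applied to the restrictions of \<open>h\<close> at countably
  many endpoints j/(m+1). Boundedness by \<open>C\<close> makes the integral
  \<open>C\<close>-Lipschitz in its endpoint, uniformly in \<theta>.\<close>

lemma AE_uniform_limit_osc_integral_bounded:
  assumes h [measurable]: "h \<in> borel_measurable unit_lebesgue" and C: "\<And>s. \<bar>h s\<bar> \<le> C"
  shows "AE \<omega> in M. uniform_limit {0..1}
    (\<lambda>\<theta> t. osc_integral (\<lambda>s. indicator {0..t} s * h s) (\<lambda>s. X s \<omega>) \<theta>) (\<lambda>_. 0) at_top"
proof -
  interpret U: finite_measure unit_lebesgue by (rule finite_measure_unit_lebesgue)
  have C0: "0 \<le> C" using C[of 0] by linarith
  have ih: "integrable unit_lebesgue (\<lambda>s. indicator {0..t} s * h s)" for t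
    using C C0 by (intro U.integrable_const_bound[where B=C]) (auto simp: indicator_def)
  have "AE \<omega> in M. \<forall>m j. (osc_integral (\<lambda>s. indicator {0..real j / real (Suc m)} s * h s) (\<lambda>s. X s \<omega>) \<longlongrightarrow> 0) at_top"
    using C C0 by (intro AE_all_countable[THEN iffD2] allI AE_osc_integral_tendsto_zero[where C=C])
      (auto simp: indicator_def)
  then show ?thesis
  proof eventually_elim
    case (elim \<omega>)
    have "norm (osc_integral (\<lambda>s. indicator {0..u} s * h s) (\<lambda>s. X s \<omega>) \<theta>
        - osc_integral (\<lambda>s. indicator {0..t} s * h s) (\<lambda>s. X s \<omega>) \<theta>) \<le> C * (u - t)"
      if "0 \<le> t" "t \<le> u" "u \<le> 1" for \<theta> t u
    proof -
      \<comment> \<open>The two restrictions can differ only on \<open>{t..u}\<close>, and there by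
        at most \<open>C\<close>.\<close>
      have "(LINT s|unit_lebesgue. \<bar>indicator {0..u} s * h s - indicator {0..t} s * h s\<bar>)
          \<le> (LINT s|unit_lebesgue. C * indicator {t..u} s)"
      proof (rule integral_mono)
        show "integrable unit_lebesgue (\<lambda>s. \<bar>indicator {0..u} s * h s - indicator {0..t} s * h s\<bar>)"
          by (intro integrable_abs Bochner_Integration.integrable_diff ih)
        show "integrable unit_lebesgue (\<lambda>s. C * indicator {t..u} s)"
          using C0 by (intro U.integrable_const_bound[where B=C]) (auto simp: indicator_def)
      qed (use C C0 that in \<open>auto simp: indicator_def\<close>)
      also have "\<dots> = C * (u - t)"
        using that by (simp add: measure_restrict_space Int_absorb1)
      finally show ?thesis
        using norm_osc_integral_diff_le[OF ih ih X_cont] by (rule order_trans[rotated])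
    qed
    note lipschitz = this
    show ?case
    proof (rule uniform_limit_zero_if_grids[where L=C])
      fix \<theta> x y :: real assume xy: "x \<in> {0..1}" "y \<in> {0..1}"
      show "norm (osc_integral (\<lambda>s. indicator {0..x} s * h s) (\<lambda>s. X s \<omega>) \<theta>
        - osc_integral (\<lambda>s. indicator {0..y} s * h s) (\<lambda>s. X s \<omega>) \<theta>) \<le> C * \<bar>x - y\<bar>"
      proof (cases "y \<le> x")
        case True
        then show ?thesis using lipschitz[of y x \<theta>] xy by simp
      next
        case False
        then show ?thesis
          using lipschitz[of x y \<theta>] xy by (subst norm_minus_commute) simp
      qed
    qed (rule elim[rule_format])
  qed
qed

text \<open>Truncations of \<open>h\<close> are covered by the bounded case, simultaneously for all
  heights \<open>n\<close>; the L^1 error of truncation is uniform in \<theta> and \<open>t\<close>,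
  so uniform convergence survives.\<close>

lemma AE_uniform_limit_osc_integral:
  assumes h: "integrable unit_lebesgue h"
  shows "AE \<omega> in M. uniform_limit {0..1}
    (\<lambda>\<theta> t. osc_integral (\<lambda>s. indicator {0..t} s * h s) (\<lambda>s. X s \<omega>) \<theta>) (\<lambda>_. 0) at_top"
proof -
  have [measurable]: "h \<in> borel_measurable unit_lebesgue" using h by auto
  define k where "k n s = (if \<bar>h s\<bar> \<le> real n then h s else 0)" for n s
  have [measurable]: "k n \<in> borel_measurable unit_lebesgue" for n
    unfolding k_def by measurable
  have ik: "integrable unit_lebesgue (k n)" for n
    using h by (rule Bochner_Integration.integrable_bound) (auto simp: k_def)
  have ind: "integrable unit_lebesgue (\<lambda>s. indicator {0..t} s * f s)"
    if "integrable unit_lebesgue f" for f :: "real \<Rightarrow> real" and t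
    using that by (intro Bochner_Integration.integrable_bound[OF that]) (auto simp: indicator_def)
  \<comment> \<open>Dominated convergence with majorant |h|: at each \<open>s\<close> the difference
    vanishes once \<open>n\<close> reaches |h s|.\<close>
  have "(\<lambda>n. LINT s|unit_lebesgue. \<bar>h s - k n s\<bar>) \<longlonglongrightarrow> (LINT s|unit_lebesgue. 0)"
  proof (rule integral_dominated_convergence)
    show "AE s in unit_lebesgue. (\<lambda>n. \<bar>h s - k n s\<bar>) \<longlonglongrightarrow> 0"
    proof (rule AE_I2)
      fix s
      have "\<forall>\<^sub>F n in sequentially. \<bar>h s - k n s\<bar> = 0"
        using eventually_ge_at_top[of "nat \<lceil>\<bar>h s\<bar>\<rceil>"]
        by eventually_elim (auto simp: k_def nat_ceiling_le_eq)
      then show "(\<lambda>n. \<bar>h s - k n s\<bar>) \<longlonglongrightarrow> 0"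
        by (rule tendsto_eventually)
    qed
    show "integrable unit_lebesgue (\<lambda>s. \<bar>h s\<bar>)" using h by simp
  qed (auto simp: k_def)
  then have L1: "(\<lambda>n. LINT s|unit_lebesgue. \<bar>h s - k n s\<bar>) \<longlonglongrightarrow> 0" by simp
  have "AE \<omega> in M. \<forall>n. uniform_limit {0..1}
    (\<lambda>\<theta> t. osc_integral (\<lambda>s. indicator {0..t} s * k n s) (\<lambda>s. X s \<omega>) \<theta>) (\<lambda>_. 0) at_top"
  proof (intro AE_all_countable[THEN iffD2] allI)
    fix n
    have "\<bar>k n s\<bar> \<le> real n" for s by (auto simp: k_def)
    then show "AE \<omega> in M. uniform_limit {0..1}
        (\<lambda>\<theta> t. osc_integral (\<lambda>s. indicator {0..t} s * k n s) (\<lambda>s. X s \<omega>) \<theta>) (\<lambda>_. 0) at_top"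
      by (intro AE_uniform_limit_osc_integral_bounded) auto
  qed
  then show ?thesis
  proof eventually_elim
    case (elim \<omega>)
    let ?F = "\<lambda>f \<theta> t. osc_integral (\<lambda>s. indicator {0..t} s * f s) (\<lambda>s. X s \<omega>) \<theta>"
    \<comment> \<open>Restricting to \<open>{0..t}\<close> can only shrink the L^1 distance, so one
      choice of \<open>n\<close> works for all \<theta> and \<open>t\<close>.\<close>
    have diff: "norm (?F h \<theta> t - ?F (k n) \<theta> t) \<le> (LINT s|unit_lebesgue. \<bar>h s - k n s\<bar>)" for \<theta> t n
    proof -
      have "(LINT s|unit_lebesgue. \<bar>indicator {0..t} s * h s - indicator {0..t} s * k n s\<bar>)
          \<le> (LINT s|unit_lebesgue. \<bar>h s - k n s\<bar>)"
        by (intro integral_mono integrable_abs Bochner_Integration.integrable_diff ind h ik)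
          (auto simp: indicator_def)
      then show ?thesis
        using norm_osc_integral_diff_le[OF ind[OF h] ind[OF ik] X_cont] by (rule order_trans[rotated])
    qed
    show ?case
    proof (rule uniform_limitI)
      fix e :: real assume e: "0 < e"
      have "\<forall>\<^sub>F n in sequentially. (LINT s|unit_lebesgue. \<bar>h s - k n s\<bar>) < e / 2"
        using L1 e by (intro order_tendstoD) auto
      then obtain n where n: "(LINT s|unit_lebesgue. \<bar>h s - k n s\<bar>) < e / 2"
        by (auto dest: eventually_happens)
      have "\<forall>\<^sub>F \<theta> in at_top. \<forall>t\<in>{0..1}. dist (?F (k n) \<theta> t) 0 < e / 2"
        using elim e by (intro uniform_limitD) auto
      then show "\<forall>\<^sub>F \<theta> in at_top. \<forall>t\<in>{0..1}. dist (?F h \<theta> t) 0 < e"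
      proof eventually_elim
        case (elim \<theta>)
        show ?case
        proof
          fix t :: real assume "t \<in> {0..1}"
          then have "dist (?F (k n) \<theta> t) 0 < e / 2" using elim by blast
          then show "dist (?F h \<theta> t) 0 < e"
            using diff[of t \<theta> n] n norm_triangle_sub[of "?F h \<theta> t" "?F (k n) \<theta> t"]
            unfolding dist_norm diff_zero by linarith
        qed
      qed
    qed
  qed
qed

end

section \<open>Return to the original process and to vector-valued functions\<close>

lemma AE_uniform_limit_component:
  assumes h: "integrable unit_lebesgue h"
  shows "AE \<omega> in M. uniform_limit {0..1}
    (\<lambda>T t. LINT s:{0..t}|lebesgue. complex_of_real (h s) * iexp (sqrt T * B s \<omega>)) (\<lambda>_. 0) at_top"
proof -
  obtain X where X: "\<And>t. X t \<in> borel_measurable M" "\<And>\<omega>. continuous_on UNIV (\<lambda>t. X t \<omega>)"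
    "AE \<omega> in M. \<forall>t\<in>{0..1}. X t \<omega> = B t \<omega>"
    by (rule continuous_modification) blast
  show ?thesis
    using AE_uniform_limit_osc_integral[OF X h] X(3)
  proof eventually_elim
    case (elim \<omega>)
    \<comment> \<open>For this \<omega> the paths of \<open>X\<close> and \<open>B\<close> coincide
      on all of [0,1], and the indicator becomes the domain of integration.\<close>
    have eq: "osc_integral (\<lambda>s. indicator {0..t} s * h s) (\<lambda>s. X s \<omega>) (sqrt T)
        = (LINT s:{0..t}|lebesgue. complex_of_real (h s) * iexp (sqrt T * B s \<omega>))" if "t \<in> {0..1}" for t T
      unfolding set_lebesgue_integral_def using elim(2) that
      by (subst integral_restrict_space) (auto intro!: Bochner_Integration.integral_cong simp: indicator_def)
    show ?case
    proof (rule uniform_limitI)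
      fix e :: real assume "0 < e"
      \<comment> \<open>The substitution \<theta> = \<open>sqrt T\<close> is legitimate because the
        square root tends to infinity.\<close>
      from uniform_limitD[OF elim(1) this]
      have "\<forall>\<^sub>F T in at_top. \<forall>t\<in>{0..1}. dist (osc_integral (\<lambda>s. indicator {0..t} s * h s) (\<lambda>s. X s \<omega>) (sqrt T)) 0 < e"
        by (rule eventually_compose_filterlim[OF _ sqrt_at_top])
      then show "\<forall>\<^sub>F T in at_top. \<forall>t\<in>{0..1}.
          dist (LINT s:{0..t}|lebesgue. complex_of_real (h s) * iexp (sqrt T * B s \<omega>)) 0 < e"
        by eventually_elim (simp only: eq ball_triv simp_thms cong: ball_cong)
    qed
  qed
qed

end

text \<open>The Euclidean norm is at most the sum of the coordinate norms, so a tolerance of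
  \<open>e / real CARD('k)\<close> in each of the finitely many coordinates suffices.\<close>

lemma uniform_limit_zero_vec:
  fixes F :: "'c \<Rightarrow> 'd \<Rightarrow> 'b::real_normed_vector ^ 'k"
  assumes "\<And>i. uniform_limit S (\<lambda>x t. F x t $ i) (\<lambda>_. 0) A"
  shows "uniform_limit S F (\<lambda>_. 0) A"
proof (rule uniform_limitI)
  fix e :: real assume "0 < e"
  then have e: "0 < e / real CARD('k)" by simp
  have "\<forall>\<^sub>F x in A. \<forall>i\<in>UNIV. \<forall>t\<in>S. dist (F x t $ i) 0 < e / real CARD('k)"
    using uniform_limitD[OF assms e] by (intro eventually_ball_finite) auto
  then show "\<forall>\<^sub>F x in A. \<forall>t\<in>S. dist (F x t) 0 < e"
  proof eventually_elim
    case (elim x)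
    show ?case
    proof
      fix t assume "t \<in> S"
      have "norm (F x t) \<le> (\<Sum>i\<in>UNIV. norm (F x t $ i))"
        unfolding norm_vec_def by (rule L2_set_le_sum) simp
      also have "\<dots> < (\<Sum>i\<in>(UNIV::'k set). e / real CARD('k))"
        using elim \<open>t \<in> S\<close> by (intro sum_strict_mono) auto
      finally show "dist (F x t) 0 < e" by simp
    qed
  qed
qed

theorem theorem3p1:
  fixes M :: "'a measure" and B :: "real \<Rightarrow> 'a \<Rightarrow> real" and g :: "real \<Rightarrow> real ^ 'k"
  assumes "std_brownian_motion_01 M B"
    and "g absolutely_integrable_on {0..1}"
  shows "AE \<omega> in M. uniform_limit {0..1}
           (\<lambda>(T::real) t. (\<chi> k. LINT s:{0..t}|lebesgue.
               complex_of_real (g s $ k) * exp (\<i> * complex_of_real (sqrt T * B s \<omega>))))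
           (\<lambda>t. (0 :: complex ^ 'k)) at_top"
proof -
  interpret std_brownian_motion_01 M B by fact
  have "integrable unit_lebesgue g"
    using assms(2) by (simp add: absolutely_integrable_on_def set_integrable_def integrable_restrict_space)
  then have "integrable unit_lebesgue (\<lambda>s. g s $ k)" for k
    using integrable_bounded_linear[OF bounded_linear_vec_nth] by blast
  \<comment> \<open>Finitely many coordinates share one exceptional null set.\<close>
  then have "AE \<omega> in M. \<forall>k\<in>UNIV. uniform_limit {0..1} (\<lambda>T t. LINT s:{0..t}|lebesgue.
      complex_of_real (g s $ k) * iexp (sqrt T * B s \<omega>)) (\<lambda>_. 0) at_top"
    by (intro AE_finite_allI AE_uniform_limit_component) auto
  then show ?thesis
    by eventually_elim (auto intro!: uniform_limit_zero_vec)
qed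

end
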